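(* Let $S\subseteq\mathbb{H}$ be open and let $f:S\to\mathbb{R}$ be continuous, such that its left HR derivatives up to order three exist and are continuous in $S$. If $q_0,q_0+\lambda\in S$ are such that the segment joining them is also in $S$, then, as $\lambda\to0$, $$f(q_0+\lambda)-f(q_0)=\sum_{\mu}\frac{\partial f(q_0)}{\partial q^{\mu}}\lambda^{\mu}+\frac12\sum_{\mu,\nu}\lambda^{\mu*}\frac{\partial^2 f(q_0)}{\partial q^{\nu}\partial q^{\mu*}}\lambda^{\nu}+O(|\lambda|^3)$$ $$=\sum_{\mu}\frac{\partial f(q_0)}{\partial q^{\mu*}}\lambda^{\mu*}+\frac12\sum_{\mu,\nu}\lambda^{\mu}\frac{\partial^2 f(q_0)}{\partial q^{\nu*}\partial q^{\mu}}\lambda^{\nu*}+O(|\lambda|^3),$$ where the sums run over $\mu,\nu\in\{1,i,j,k\}$.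
   Context: $\mathbb{H}$ denotes the real quaternions $q=q_a+iq_b+jq_c+kq_d$ with $q_a,q_b,q_c,q_d\in\mathbb{R}$ and $i^2=j^2=k^2=ijk=-1$. The conjugate is $q^*=q_a-iq_b-jq_c-kq_d$, and $|q|=\sqrt{qq^*}$. For $\mu\in\{1,i,j,k\}$ and $p\in\mathbb{H}$, $p^{\mu}:=\mu p\mu^{-1}$ and $p^{\mu*}:=(p^{\mu})^*$. An $\mathbb{H}$-valued (in particular, real-valued) function $f$ is regarded as a function of the four real variables $q_a,q_b,q_c,q_d$, with ($\mathbb{H}$-valued, componentwise) partial derivatives $\frac{\partial f}{\partial q_a},\dots,\frac{\partial f}{\partial q_d}$. The left HR derivatives of $f$ are, for $\mu\in\{1,i,j,k\}$, $$\frac{\partial f}{\partial q^{\mu}}=\frac14\left(\frac{\partial f}{\partial q_a}-\frac{\partial f}{\partial q_b}i^{\mu}-\frac{\partial f}{\partial q_c}j^{\mu}-\frac{\partial f}{\partial q_d}k^{\mu}\right),\qquad \frac{\partial f}{\partial q^{\mu*}}=\frac14\left(\frac{\partial f}{\partial q_a}+\frac{\partial f}{\partial q_b}i^{\mu}+\frac{\partial f}{\partial q_c}j^{\mu}+\frac{\partial f}{\partial q_d}k^{\mu}\right).$$ Higher-order left HR derivatives are iterated ones: $\frac{\partial^2 f}{\partial q^{\nu}\partial q^{\mu*}}=\frac{\partial}{\partial q^{\nu}}\left(\frac{\partial f}{\partial q^{\mu*}}\right)$, $\frac{\partial^2 f}{\partial q^{\nu*}\partial q^{\mu}}=\frac{\partial}{\partial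 q^{\nu*}}\left(\frac{\partial f}{\partial q^{\mu}}\right)$, and similarly for other choices and for third order. *)

theory Defs
  imports "HOL-Analysis.Analysis" "HOL-Library.Landau_Symbols"
begin

section \<open>The real quaternions\<close>

codatatype quat = Quat (qa: real) (qb: real) (qc: real) (qd: real)

lemma quat_eqI [intro?]:
  "qa x = qa y \<Longrightarrow> qb x = qb y \<Longrightarrow> qc x = qc y \<Longrightarrow> qd x = qd y \<Longrightarrow> x = y"
  by (rule quat.expand) simp

lemma quat_eq_iff: "x = y \<longleftrightarrow> qa x = qa y \<and> qb x = qb y \<and> qc x = qc y \<and> qd x = qd y"
  by (auto intro: quat.expand)

instantiation quat :: ab_group_add
begin

primcorec zero_quat where
    "qa 0 = 0"
  | "qb 0 = 0"
  | "qc 0 = 0"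
  | "qd 0 = 0"

primcorec plus_quat where
    "qa (x + y) = qa x + qa y"
  | "qb (x + y) = qb x + qb y"
  | "qc (x + y) = qc x + qc y"
  | "qd (x + y) = qd x + qd y"

primcorec uminus_quat where
    "qa (- x) = - qa x"
  | "qb (- x) = - qb x"
  | "qc (- x) = - qc x"
  | "qd (- x) = - qd x"

primcorec minus_quat where
    "qa (x - y) = qa x - qa y"
  | "qb (x - y) = qb x - qb y"
  | "qc (x - y) = qc x - qc y"
  | "qd (x - y) = qd x - qd y"

instance
  by standard (simp_all add: quat_eq_iff)

end

instantiation quat :: ring_1
begin

primcorec one_quat where
    "qa 1 = 1"
  | "qb 1 = 0"
  | "qc 1 = 0"
  | "qd 1 = 0"

primcorec times_quat where
    "qa (x * y) = qa x * qa y - qb x * qb y - qc x * qc y - qd x * qd y"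
  | "qb (x * y) = qa x * qb y + qb x * qa y + qc x * qd y - qd x * qc y"
  | "qc (x * y) = qa x * qc y - qb x * qd y + qc x * qa y + qd x * qb y"
  | "qd (x * y) = qa x * qd y + qb x * qc y - qc x * qb y + qd x * qa y"

instance
  by standard (simp_all add: quat_eq_iff algebra_simps)

end

lemma quat_sum_squares_eq_0:
  "(qa x)\<^sup>2 + (qb x)\<^sup>2 + (qc x)\<^sup>2 + (qd x)\<^sup>2 = 0 \<longleftrightarrow> x = 0"
  by (simp add: quat_eq_iff add_nonneg_eq_0_iff)

instantiation quat :: real_div_algebra
begin

primcorec scaleR_quat where
    "qa (scaleR r x) = r * qa x"
  | "qb (scaleR r x) = r * qb x"
  | "qc (scaleR r x) = r * qc x"
  | "qd (scaleR r x) = r * qd x"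

primcorec inverse_quat where
    "qa (inverse x) = qa x / ((qa x)\<^sup>2 + (qb x)\<^sup>2 + (qc x)\<^sup>2 + (qd x)\<^sup>2)"
  | "qb (inverse x) = - qb x / ((qa x)\<^sup>2 + (qb x)\<^sup>2 + (qc x)\<^sup>2 + (qd x)\<^sup>2)"
  | "qc (inverse x) = - qc x / ((qa x)\<^sup>2 + (qb x)\<^sup>2 + (qc x)\<^sup>2 + (qd x)\<^sup>2)"
  | "qd (inverse x) = - qd x / ((qa x)\<^sup>2 + (qb x)\<^sup>2 + (qc x)\<^sup>2 + (qd x)\<^sup>2)"

definition "x div y = x * inverse y" for x y :: quat

instance
proof
  fix x :: quat
  assume "x \<noteq> 0"
  then have *: "(qa x)\<^sup>2 + (qb x)\<^sup>2 + (qc x)\<^sup>2 + (qd x)\<^sup>2 \<noteq> 0"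
    by (simp add: quat_sum_squares_eq_0)
  have 1: "qa x * (qa x / N) + qb x * (qb x / N) + qc x * (qc x / N) + qd x * (qd x / N) = 1"
    if "N = (qa x)\<^sup>2 + (qb x)\<^sup>2 + (qc x)\<^sup>2 + (qd x)\<^sup>2" for N
    using * that by (simp add: power2_eq_square flip: add_divide_distrib)
  show "inverse x * x = 1"
    using 1[OF refl] by (simp add: quat_eq_iff mult.commute)
  show "x * inverse x = 1"
    using 1[OF refl] by (simp add: quat_eq_iff mult.commute)
qed (simp_all add: quat_eq_iff divide_quat_def algebra_simps)

end

instantiation quat :: real_inner
begin

definition inner_quat :: "quat \<Rightarrow> quat \<Rightarrow> real" where
  "inner_quat x y = qa x * qa y + qb x * qb y + qc x * qc y + qd x * qd y"

definition norm_quat :: "quat \<Rightarrow> real" where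
  "norm_quat x = sqrt ((qa x)\<^sup>2 + (qb x)\<^sup>2 + (qc x)\<^sup>2 + (qd x)\<^sup>2)"

definition sgn_quat :: "quat \<Rightarrow> quat" where
  "sgn_quat x = x /\<^sub>R norm x"

definition dist_quat :: "quat \<Rightarrow> quat \<Rightarrow> real" where
  "dist_quat x y = norm (x - y)"

definition uniformity_quat :: "(quat \<times> quat) filter" where
  "uniformity_quat = (INF e\<in>{0 <..}. principal {(x, y). dist x y < e})"

definition open_quat :: "quat set \<Rightarrow> bool" where
  "open_quat U \<longleftrightarrow> (\<forall>x\<in>U. eventually (\<lambda>(x', y). x' = x \<longrightarrow> y \<in> U) uniformity)"

instance
proof
  fix x y z :: quat and r :: real
  show "inner x y = inner y x"
    by (simp add: inner_quat_def mult.commute)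
  show "inner (x + y) z = inner x z + inner y z"
    by (simp add: inner_quat_def algebra_simps)
  show "inner (r *\<^sub>R x) y = r * inner x y"
    by (simp add: inner_quat_def algebra_simps)
  show "0 \<le> inner x x"
    by (simp add: inner_quat_def)
  show "inner x x = 0 \<longleftrightarrow> x = 0"
    using quat_sum_squares_eq_0[of x] by (simp add: inner_quat_def power2_eq_square)
  show "norm x = sqrt (inner x x)"
    by (simp add: inner_quat_def norm_quat_def power2_eq_square)
qed (rule sgn_quat_def dist_quat_def open_quat_def uniformity_quat_def)+

end

instance quat :: real_normed_div_algebra
proof
  fix x y :: quat
  have "(qa (x * y))\<^sup>2 + (qb (x * y))\<^sup>2 + (qc (x * y))\<^sup>2 + (qd (x * y))\<^sup>2
      = ((qa x)\<^sup>2 + (qb x)\<^sup>2 + (qc x)\<^sup>2 + (qd x)\<^sup>2) * ((qa y)\<^sup>2 + (qb y)\<^sup>2 + (qc y)\<^sup>2 + (qd y)\<^sup>2)"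
    unfolding times_quat.simps by algebra
  then show "norm (x * y) = norm x * norm y"
    by (simp only: norm_quat_def real_sqrt_mult)
qed

primcorec quat_i :: quat where
    "qa quat_i = 0"
  | "qb quat_i = 1"
  | "qc quat_i = 0"
  | "qd quat_i = 0"

primcorec quat_j :: quat where
    "qa quat_j = 0"
  | "qb quat_j = 0"
  | "qc quat_j = 1"
  | "qd quat_j = 0"

primcorec quat_k :: quat where
    "qa quat_k = 0"
  | "qb quat_k = 0"
  | "qc quat_k = 0"
  | "qd quat_k = 1"

instantiation quat :: euclidean_space
begin

definition "Basis = {1, quat_i, quat_j, quat_k}"

instance
proof
  show "(\<forall>u\<in>Basis. inner x u = 0) \<longleftrightarrow> x = 0" for x :: quat
    by (simp add: Basis_quat_def inner_quat_def quat_eq_iff[of x 0])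
  show "inner u v = (if u = v then 1 else 0)" if "u \<in> Basis" "v \<in> Basis" for u v :: quat
    using that unfolding Basis_quat_def insert_iff empty_iff
    by (elim disjE; simp add: inner_quat_def quat_eq_iff)
qed (simp_all add: Basis_quat_def)

end

lemma quat_i_j_k:
  "quat_i * quat_i = -1" "quat_j * quat_j = -1" "quat_k * quat_k = -1"
  "quat_i * quat_j * quat_k = -1"
  by (simp_all add: quat_eq_iff)

lemma quat_decompose:
  "q = of_real (qa q) + quat_i * of_real (qb q) + quat_j * of_real (qc q) + quat_k * of_real (qd q)"
  by (simp add: quat_eq_iff of_real_def)

primcorec qcnj :: "quat \<Rightarrow> quat" where
    "qa (qcnj q) = qa q"
  | "qb (qcnj q) = - qb q"
  | "qc (qcnj q) = - qc q"
  | "qd (qcnj q) = - qd q"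

lemma quat_mult_qcnj: "q * qcnj q = of_real ((norm q)\<^sup>2)"
  by (simp add: quat_eq_iff norm_quat_def of_real_def power2_eq_square)

definition qrot :: "quat \<Rightarrow> quat \<Rightarrow> quat" where
  "qrot \<mu> p = \<mu> * p * inverse \<mu>"

abbreviation qunits :: "quat set" where
  "qunits \<equiv> {1, quat_i, quat_j, quat_k}"

section \<open>Left HR derivatives\<close>

text \<open>
  The partial derivatives with respect to the four real coordinates are the derivatives along the
  directions \<open>1\<close>, \<open>i\<close>, \<open>j\<close>, \<open>k\<close>.
\<close>

definition qpartial :: "quat \<Rightarrow> (quat \<Rightarrow> quat) \<Rightarrow> quat \<Rightarrow> quat" where
  "qpartial e f q = vector_derivative (\<lambda>t::real. f (q + t *\<^sub>R e)) (at 0)"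

text \<open>
  The left HR derivatives of \<open>f\<close> at \<open>q\<close> exist, by definition, when the four partial derivatives in
  their defining formula do; this does not depend on \<open>\<mu>\<close>, nor on whether the derivative is taken
  with respect to \<open>q\<^sup>\<mu>\<close> or \<open>q\<^sup>\<mu>\<^sup>*\<close>.
\<close>

definition HR_differentiable_at :: "(quat \<Rightarrow> quat) \<Rightarrow> quat \<Rightarrow> bool" where
  "HR_differentiable_at f q \<longleftrightarrow>
     (\<forall>e\<in>qunits. (\<lambda>t::real. f (q + t *\<^sub>R e)) differentiable (at 0))"

definition HR_deriv :: "quat \<Rightarrow> (quat \<Rightarrow> quat) \<Rightarrow> quat \<Rightarrow> quat" where
  "HR_deriv \<mu> f q = (1/4) *\<^sub>R
     (qpartial 1 f q - qpartial quat_i f q * qrot \<mu> quat_i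
       - qpartial quat_j f q * qrot \<mu> quat_j - qpartial quat_k f q * qrot \<mu> quat_k)"

definition HR_cderiv :: "quat \<Rightarrow> (quat \<Rightarrow> quat) \<Rightarrow> quat \<Rightarrow> quat" where
  "HR_cderiv \<mu> f q = (1/4) *\<^sub>R
     (qpartial 1 f q + qpartial quat_i f q * qrot \<mu> quat_i
       + qpartial quat_j f q * qrot \<mu> quat_j + qpartial quat_k f q * qrot \<mu> quat_k)"

text \<open>
  \<open>HR_derivs_upto n f S\<close>: all iterated left HR derivatives of \<open>f\<close> of orders \<open>1, \<dots>, n\<close>, for every
  choice of \<open>q\<^sup>\<mu>\<close> or \<open>q\<^sup>\<mu>\<^sup>*\<close> at each step, exist and are continuous in the (open) set \<open>S\<close>.
\<close>

primrec HR_derivs_upto :: "nat \<Rightarrow> (quat \<Rightarrow> quat) \<Rightarrow> quat set \<Rightarrow> bool" where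
  "HR_derivs_upto 0 f S \<longleftrightarrow> True"
| "HR_derivs_upto (Suc n) f S \<longleftrightarrow>
     (\<forall>q\<in>S. HR_differentiable_at f q) \<and>
     (\<forall>\<mu>\<in>qunits. continuous_on S (HR_deriv \<mu> f) \<and> HR_derivs_upto n (HR_deriv \<mu> f) S) \<and>
     (\<forall>\<mu>\<in>qunits. continuous_on S (HR_cderiv \<mu> f) \<and> HR_derivs_upto n (HR_cderiv \<mu> f) S)"

end

theory Submission
  imports Defs
begin

text \<open>
  Two facts combine. The first is quaternionic: for \<open>\<mu>\<close> running through \<open>1, i, j, k\<close>, the rotations
  \<open>p\<^sup>\<mu> = \<mu> p \<mu>\<inverse>\<close> are automorphisms that fix the real part and change the signs of the imaginary
  parts in such a way that these cancel in the sum. Hence \<open>\<Sum>\<mu>. p\<^sup>\<mu>\<close> is four times the real part of \<open>p\<close>,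
  and applying this to \<open>p\<^sup>* q\<close> and to \<open>p q\<^sup>*\<close> gives the frame identities
  \<open>\<Sum>\<mu>. p\<^sup>\<mu>\<^sup>* q\<^sup>\<mu> = 4 (p \<bullet> q) = \<Sum>\<mu>. p\<^sup>\<mu> q\<^sup>\<mu>\<^sup>*\<close>, which are lemmas \<open>sum_qcnj_qrot_mult_qrot\<close> and
  \<open>sum_qrot_mult_qcnj_qrot\<close>. The HR derivatives are
  \<open>\<partial>f/\<partial>q\<^sup>\<mu> = 1/4 \<Sum>e. \<partial>\<^sub>e f e\<^sup>\<mu>\<^sup>*\<close> and \<open>\<partial>f/\<partial>q\<^sup>\<mu>\<^sup>* = 1/4 \<Sum>e. \<partial>\<^sub>e f e\<^sup>\<mu>\<close>, where \<open>e\<close> runs through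
  \<open>1, i, j, k\<close>, so the frame identities turn the first-order sums of the theorem into
  \<open>\<Sum>e. \<partial>\<^sub>e f (h \<bullet> e)\<close>. In the second-order sums the second partial derivatives of a real function
  are real, so they can be moved past the quaternions to their left; the same identities, used once for \<open>\<mu>\<close> and
  once for \<open>\<nu>\<close>, leave \<open>\<Sum>a b. (h \<bullet> a) (h \<bullet> b) \<partial>\<^sub>b \<partial>\<^sub>a f\<close> (lemma \<open>quadratic_frame_form\<close>).
  Thus both expressions in the theorem are the ordinary second Taylor polynomial of \<open>f\<close> in four real
  variables.

  The second fact is the Taylor theorem in four variables (lemma \<open>second_order_Taylor_bound\<close>). It
  needs continuous partial derivatives up to order three, whereas the hypothesis speaks of iterated
  HR derivatives. The frame identity with \<open>h = e\<close> inverts the definition,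
  \<open>\<partial>\<^sub>e f = \<Sum>\<mu>. \<partial>f/\<partial>q\<^sup>\<mu> e\<^sup>\<mu>\<close>, with constants on the right. Partial differentiation commutes with
  right multiplication by constants, and so the regularity passes from the HR derivatives to
  the partial derivatives by induction on the order (lemma \<open>HR_derivs_upto_imp_partials_upto\<close>).
\<close>

section \<open>Taylor expansion from continuous partial derivatives\<close>

text \<open>
  The increment along \<open>h\<close> is split into moves parallel to the coordinate axes. On each move
  the mean value inequality applies to the function minus its presumed linear part, whose
  slope \<open>g' e y - g' e x\<close> is uniformly small near \<open>x\<close>.
\<close>

lemma has_derivative_continuous_partials:
  fixes g :: "'a::euclidean_space \<Rightarrow> 'b::real_normed_vector"
  assumes S: "open S" and x: "x \<in> S"
    and part: "\<And>e y. e \<in> Basis \<Longrightarrow> y \<in> S \<Longrightarrow> ((\<lambda>t. g (y + t *\<^sub>R e)) has_vector_derivative g' e y) (at 0)"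
    and cont: "\<And>e. e \<in> Basis \<Longrightarrow> continuous_on S (g' e)"
  shows "(g has_derivative (\<lambda>h. \<Sum>e\<in>Basis. (h \<bullet> e) *\<^sub>R g' e x)) (at x)"
  unfolding has_derivative_at_alt
proof (intro conjI allI impI)
  show "bounded_linear (\<lambda>h. \<Sum>e\<in>Basis. (h \<bullet> e) *\<^sub>R g' e x)"
    by (intro bounded_linear_sum bounded_linear_scaleR_const bounded_linear_inner_left)
  fix \<epsilon> :: real assume \<epsilon>: "0 < \<epsilon>"
  define n where "n = real DIM('a)"
  have n: "n > 0" by (simp add: n_def)
  have "eventually (\<lambda>y. \<forall>e\<in>Basis. y \<in> S \<and> dist (g' e y) (g' e x) < \<epsilon> / n) (at x)"
  proof (intro eventually_ball_finite ballI eventually_conj)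
    show "eventually (\<lambda>y. y \<in> S) (at x)"
      using S x by (rule eventually_at_in_open')
    fix e :: 'a assume "e \<in> Basis"
    then have "isCont (g' e) x"
      using cont S x continuous_on_eq_continuous_at by blast
    then show "eventually (\<lambda>y. dist (g' e y) (g' e x) < \<epsilon> / n) (at x)"
      unfolding isCont_def by (rule tendstoD) (simp add: \<epsilon> n)
  qed simp
  then obtain r where r: "r > 0"
    and "\<And>y e. y \<noteq> x \<Longrightarrow> dist y x < r \<Longrightarrow> e \<in> Basis \<Longrightarrow> y \<in> S \<and> dist (g' e y) (g' e x) < \<epsilon> / n"
    unfolding eventually_at by blast
  then have near: "y \<in> S" "norm (g' e y - g' e x) \<le> \<epsilon> / n" if "dist y x < r" "e \<in> Basis" for y e
    using that x \<epsilon> n by (cases "y = x"; force simp: dist_norm)+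
  show "\<exists>d>0. \<forall>y. norm (y - x) < d \<longrightarrow>
      norm (g y - g x - (\<Sum>e\<in>Basis. ((y - x) \<bullet> e) *\<^sub>R g' e x)) \<le> \<epsilon> * norm (y - x)"
  proof (intro exI[of _ "r / n"] conjI allI impI)
    show "r / n > 0" using r n by simp
    fix y assume "norm (y - x) < r / n"
    define h where "h = y - x"
    have hr: "n * norm h < r"
      using \<open>norm (y - x) < r / n\<close> n by (simp add: h_def field_simps)
    \<comment> \<open>\<open>P B\<close> is the projection of \<open>h\<close> to the span of \<open>B\<close>: adding the basis vectors to \<open>B\<close>
      one at a time walks from \<open>x\<close> to \<open>y\<close> along the axes.\<close>
    define P where "P B = (\<Sum>e\<in>B. (h \<bullet> e) *\<^sub>R e)" for B
    have small: "dist (x + P B + s *\<^sub>R e) x < r"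
      if B: "insert e B \<subseteq> Basis" "e \<notin> B" and s: "\<bar>s\<bar> \<le> \<bar>h \<bullet> e\<bar>" for B s e
    proof -
      have fin: "finite B" using B finite_subset[OF _ finite_Basis] by auto
      have "norm (P B + s *\<^sub>R e) \<le> (\<Sum>e\<in>B. norm ((h \<bullet> e) *\<^sub>R e)) + norm (s *\<^sub>R e)"
        unfolding P_def by (intro order_trans[OF norm_triangle_ineq] add_mono norm_sum order_refl)
      also have "\<dots> \<le> (\<Sum>e\<in>B. norm h) + norm h"
      proof (intro add_mono sum_mono)
        show "norm ((h \<bullet> b) *\<^sub>R b) \<le> norm h" if "b \<in> B" for b
          using B that Basis_le_norm[of b h] by auto
        show "norm (s *\<^sub>R e) \<le> norm h"
          using B s Basis_le_norm[of e h] by auto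
      qed
      also have "\<dots> = real (card (insert e B)) * norm h"
        using fin B by (simp add: algebra_simps)
      also have "\<dots> \<le> n * norm h"
        unfolding n_def using B by (intro mult_right_mono of_nat_mono card_mono) auto
      finally show ?thesis using hr by (simp add: dist_norm add.assoc)
    qed
    have "norm (g (x + P B) - g x - (\<Sum>e\<in>B. (h \<bullet> e) *\<^sub>R g' e x)) \<le> real (card B) * (\<epsilon> / n * norm h)"
      if "B \<subseteq> Basis" for B
      using finite_subset[OF that finite_Basis] that
    proof (induction B rule: finite_induct)
      case empty
      then show ?case by (simp add: P_def)
    next
      case (insert e B)
      define z where "z = x + P B"
      define c where "c = h \<bullet> e"
      have e: "e \<in> Basis" using insert by auto
      have zP: "x + P (insert e B) = z + c *\<^sub>R e"
        using insert by (simp add: P_def z_def c_def)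
      have seg: "dist (z + (t * c) *\<^sub>R e) x < r" if "t \<in> {0..1}" for t
        unfolding z_def using insert that
        by (intro small) (auto simp: c_def abs_mult intro!: mult_left_le_one_le)
      have line: "((\<lambda>t. g (z + (t * c) *\<^sub>R e) - (t * c) *\<^sub>R g' e x) has_vector_derivative
              c *\<^sub>R (g' e (z + (t * c) *\<^sub>R e) - g' e x)) (at t within {0..1})"
        if t: "t \<in> {0..1}" for t
      proof -
        have "((\<lambda>u. (u - t) * c) has_vector_derivative c) (at t)"
          by (auto intro!: derivative_eq_intros simp: has_real_derivative_iff_has_vector_derivative[symmetric])
        moreover have "((\<lambda>s. g (z + (t * c) *\<^sub>R e + s *\<^sub>R e)) has_vector_derivative
            g' e (z + (t * c) *\<^sub>R e)) (at ((t - t) * c))"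
          using part[OF e near(1)[OF seg[OF t] e]] by simp
        ultimately have 1: "((\<lambda>s. g (z + (t * c) *\<^sub>R e + s *\<^sub>R e)) \<circ> (\<lambda>u. (u - t) * c) has_vector_derivative
            c *\<^sub>R g' e (z + (t * c) *\<^sub>R e)) (at t)"
          by (rule vector_diff_chain_at)
        have 2: "(\<lambda>s. g (z + (t * c) *\<^sub>R e + s *\<^sub>R e)) \<circ> (\<lambda>u. (u - t) * c)
            = (\<lambda>u. g (z + (u * c) *\<^sub>R e))"
          by (auto simp: fun_eq_iff algebra_simps)
        have 3: "((\<lambda>u. (u * c) *\<^sub>R g' e x) has_vector_derivative c *\<^sub>R g' e x) (at t)"
          by (auto intro!: derivative_eq_intros simp: has_vector_derivative_def)
        show ?thesis
          using has_vector_derivative_diff[OF 1[unfolded 2] 3]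
          by (simp only: scaleR_diff_right has_vector_derivative_at_within)
      qed
      have slope: "norm (c *\<^sub>R (g' e (z + (t * c) *\<^sub>R e) - g' e x)) \<le> norm h * (\<epsilon> / n)"
        if "t \<in> {0..1}" for t
        unfolding norm_scaleR
        using near(2)[OF seg[OF that] e] Basis_le_norm[OF e, of h] by (intro mult_mono) (auto simp: c_def)
      have "norm ((g (z + (1 * c) *\<^sub>R e) - (1 * c) *\<^sub>R g' e x) - (g (z + (0 * c) *\<^sub>R e) - (0 * c) *\<^sub>R g' e x))
          \<le> norm h * (\<epsilon> / n) * norm (1 - 0::real)"
        unfolding has_vector_derivative_def
      proof (intro differentiable_bound[where S="{0..1::real}"] onorm_le)
        fix t s :: real assume "t \<in> {0..1}"
        from mult_left_mono[OF slope[OF this], of "\<bar>s\<bar>"]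
        show "norm (s *\<^sub>R c *\<^sub>R (g' e (z + (t * c) *\<^sub>R e) - g' e x)) \<le> norm h * (\<epsilon> / n) * norm s"
          by (simp only: norm_scaleR real_norm_def abs_ge_zero mult.commute)
      qed (use line[unfolded has_vector_derivative_def] in simp_all)
      then have step: "norm (g (z + c *\<^sub>R e) - g z - c *\<^sub>R g' e x) \<le> \<epsilon> / n * norm h"
        by (simp add: algebra_simps)
      have "norm (g (x + P (insert e B)) - g x - (\<Sum>e\<in>insert e B. (h \<bullet> e) *\<^sub>R g' e x))
          = norm ((g (z + c *\<^sub>R e) - g z - c *\<^sub>R g' e x)
              + (g (x + P B) - g x - (\<Sum>e\<in>B. (h \<bullet> e) *\<^sub>R g' e x)))"
        unfolding zP using insert by (simp add: z_def c_def algebra_simps)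
      also have "\<dots> \<le> \<epsilon> / n * norm h + real (card B) * (\<epsilon> / n * norm h)"
        using insert by (intro order_trans[OF norm_triangle_ineq] add_mono step) auto
      also have "\<dots> = real (card (insert e B)) * (\<epsilon> / n * norm h)"
        using insert by (simp add: algebra_simps add_divide_distrib)
      finally show ?case .
    qed
    from this[of Basis] show "norm (g y - g x - (\<Sum>e\<in>Basis. ((y - x) \<bullet> e) *\<^sub>R g' e x)) \<le> \<epsilon> * norm (y - x)"
      using n by (simp add: P_def euclidean_representation h_def n_def)
  qed
qed

text \<open>
  The one-variable Taylor formula with integral remainder along the segment \<open>t \<mapsto> x + t h\<close>. The
  integrand is a cubic form in \<open>h\<close> whose coefficients, the third partial derivatives, are bounded
  by compactness on a closed ball around \<open>x\<close>.
\<close>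

lemma second_order_Taylor_bound:
  fixes g :: "'a::euclidean_space \<Rightarrow> 'b::banach"
  assumes S: "open S" and x: "x \<in> S"
    and d1: "\<And>y. y \<in> S \<Longrightarrow> (g has_derivative (\<lambda>h. \<Sum>a\<in>Basis. (h \<bullet> a) *\<^sub>R g1 a y)) (at y)"
    and d2: "\<And>a y. a \<in> Basis \<Longrightarrow> y \<in> S \<Longrightarrow>
      (g1 a has_derivative (\<lambda>h. \<Sum>b\<in>Basis. (h \<bullet> b) *\<^sub>R g2 a b y)) (at y)"
    and d3: "\<And>a b y. a \<in> Basis \<Longrightarrow> b \<in> Basis \<Longrightarrow> y \<in> S \<Longrightarrow>
      (g2 a b has_derivative (\<lambda>h. \<Sum>c\<in>Basis. (h \<bullet> c) *\<^sub>R g3 a b c y)) (at y)"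
    and cont: "\<And>a b c. a \<in> Basis \<Longrightarrow> b \<in> Basis \<Longrightarrow> c \<in> Basis \<Longrightarrow> continuous_on S (g3 a b c)"
  obtains r M where "r > 0"
    and "\<And>h. norm h < r \<Longrightarrow>
      norm (g (x + h) - g x - ((\<Sum>a\<in>Basis. (h \<bullet> a) *\<^sub>R g1 a x)
        + (1/2) *\<^sub>R (\<Sum>a\<in>Basis. \<Sum>b\<in>Basis. ((h \<bullet> a) * (h \<bullet> b)) *\<^sub>R g2 a b x))) \<le> M * norm h ^ 3"
proof -
  obtain r where r: "r > 0" "cball x r \<subseteq> S"
    using S x open_contains_cball by blast
  define N where "N y = (\<Sum>a\<in>Basis. \<Sum>b\<in>Basis. \<Sum>c\<in>Basis. norm (g3 a b c y))" for y
  have "continuous_on (cball x r) N"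
    unfolding N_def by (intro continuous_intros continuous_on_subset[OF cont r(2)])
  then have "bounded (N ` cball x r)"
    by (intro compact_imp_bounded compact_continuous_image compact_cball)
  then obtain M where M: "\<And>y. y \<in> cball x r \<Longrightarrow> norm (N y) \<le> M"
    unfolding bounded_iff by blast
  show ?thesis
  proof (rule that[OF r(1)])
    fix h :: 'a assume h: "norm h < r"
    have in_cball: "x + t *\<^sub>R h \<in> cball x r" if "t \<in> {0..1}" for t
      using that h mult_left_le_one_le[of "norm h" "\<bar>t\<bar>"] by (auto simp: dist_norm)
    have in_S: "x + t *\<^sub>R h \<in> S" if "t \<in> {0..1}" for t
      using in_cball[OF that] r by auto
    have line: "((\<lambda>t. f (x + t *\<^sub>R h)) has_vector_derivative f' h) (at t within T)"
      if "(f has_derivative f') (at (x + t *\<^sub>R h))" for f :: "'a \<Rightarrow> 'b" and f' t T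
    proof -
      have "((\<lambda>t. x + t *\<^sub>R h) has_derivative (\<lambda>t. t *\<^sub>R h)) (at t)"
        by (auto intro!: derivative_eq_intros)
      from has_derivative_compose[OF this that]
      have "((\<lambda>t. f (x + t *\<^sub>R h)) has_derivative (\<lambda>t. t *\<^sub>R f' h)) (at t)"
        using has_derivative_bounded_linear[OF that] by (simp add: linear_simps)
      then show ?thesis
        by (simp add: has_vector_derivative_def has_derivative_at_withinI)
    qed
    define D where "D m t =
      (if m = 0 then g (x + t *\<^sub>R h)
       else if m = 1 then \<Sum>a\<in>Basis. (h \<bullet> a) *\<^sub>R g1 a (x + t *\<^sub>R h)
       else if m = 2 then \<Sum>a\<in>Basis. \<Sum>b\<in>Basis. ((h \<bullet> a) * (h \<bullet> b)) *\<^sub>R g2 a b (x + t *\<^sub>R h)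
       else \<Sum>a\<in>Basis. \<Sum>b\<in>Basis. \<Sum>c\<in>Basis. ((h \<bullet> a) * (h \<bullet> b) * (h \<bullet> c)) *\<^sub>R g3 a b c (x + t *\<^sub>R h))"
      for m :: nat and t :: real
    have D': "(D m has_vector_derivative D (Suc m) t) (at t within {0..1})"
      if "m < 3" "0 \<le> t" "t \<le> 1" for m t
    proof -
      have t: "x + t *\<^sub>R h \<in> S" using that in_S by simp
      have "m = 0 \<or> m = 1 \<or> m = 2" using that by auto
      then show ?thesis
      proof (elim disjE)
        assume "m = 0"
        then show ?thesis
          using line[OF d1[OF t]] by (simp add: D_def[abs_def])
      next
        assume m: "m = 1"
        have "((\<lambda>t. \<Sum>a\<in>Basis. (h \<bullet> a) *\<^sub>R g1 a (x + t *\<^sub>R h)) has_vector_derivative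
            (\<Sum>a\<in>Basis. (h \<bullet> a) *\<^sub>R (\<Sum>b\<in>Basis. (h \<bullet> b) *\<^sub>R g2 a b (x + t *\<^sub>R h)))) (at t within {0..1})"
          by (intro has_vector_derivative_sum bounded_linear.has_vector_derivative[OF bounded_linear_scaleR_right] line d2 t)
        then show ?thesis
          using m by (simp add: D_def[abs_def] scaleR_sum_right numeral_2_eq_2[symmetric])
      next
        assume m: "m = 2"
        have "((\<lambda>t. \<Sum>a\<in>Basis. \<Sum>b\<in>Basis. ((h \<bullet> a) * (h \<bullet> b)) *\<^sub>R g2 a b (x + t *\<^sub>R h)) has_vector_derivative
            (\<Sum>a\<in>Basis. \<Sum>b\<in>Basis. ((h \<bullet> a) * (h \<bullet> b)) *\<^sub>R (\<Sum>c\<in>Basis. (h \<bullet> c) *\<^sub>R g3 a b c (x + t *\<^sub>R h)))) (at t within {0..1})"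
          by (intro has_vector_derivative_sum bounded_linear.has_vector_derivative[OF bounded_linear_scaleR_right] line d3 t)
        then show ?thesis
          using m by (simp add: D_def[abs_def] scaleR_sum_right mult.assoc)
      qed
    qed
    have "((\<lambda>t. ((1 - t) ^ (3 - 1) / fact (3 - 1)) *\<^sub>R D 3 t) has_integral
        D 0 1 - (\<Sum>i<3. ((1 - 0) ^ i / fact i) *\<^sub>R D i 0)) {0..1::real}"
      by (rule Taylor_has_integral) (use D' in auto)
    moreover have "norm (((1 - t) ^ (3 - 1) / fact (3 - 1)) *\<^sub>R D 3 t) \<le> M * norm h ^ 3"
      if t: "t \<in> {0..1}" for t
    proof -
      have "norm (((1 - t) ^ (3 - 1) / fact (3 - 1)) *\<^sub>R D 3 t) \<le> norm (D 3 t)"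
        unfolding norm_scaleR using t power_le_one[of "1 - t" 2]
        by (intro mult_left_le_one_le) (auto simp: fact_numeral)
      also have "\<dots> \<le> (\<Sum>a\<in>Basis. \<Sum>b\<in>Basis. \<Sum>c\<in>Basis.
          norm h * norm h * norm h * norm (g3 a b c (x + t *\<^sub>R h)))"
        unfolding D_def using Basis_le_norm[of _ h]
        by (auto intro!: sum_norm_le mult_right_mono mult_mono simp: abs_mult)
      also have "\<dots> = norm h ^ 3 * N (x + t *\<^sub>R h)"
        by (simp add: N_def sum_distrib_left power3_eq_cube)
      also have "\<dots> \<le> norm h ^ 3 * M"
        using M[OF in_cball[OF t]] by (intro mult_left_mono) auto
      finally show ?thesis by (simp add: mult.commute)
    qed
    moreover have "0 \<le> M" using M[of x] r by (auto intro: order_trans[OF norm_ge_zero])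
    ultimately have "norm (D 0 1 - (\<Sum>i<3. ((1 - 0) ^ i / fact i) *\<^sub>R D i 0)) \<le> M * norm h ^ 3 * measure lborel {0..1::real}"
      by (intro has_integral_bound_real[where S="{}"]) auto
    then show "norm (g (x + h) - g x - ((\<Sum>a\<in>Basis. (h \<bullet> a) *\<^sub>R g1 a x)
        + (1/2) *\<^sub>R (\<Sum>a\<in>Basis. \<Sum>b\<in>Basis. ((h \<bullet> a) * (h \<bullet> b)) *\<^sub>R g2 a b x))) \<le> M * norm h ^ 3"
      by (simp add: D_def numeral_3_eq_3 algebra_simps)
  qed
qed


section \<open>The frame identities\<close>

lemma Basis_quat_eq_qunits: "Basis = qunits"
  by (simp add: Basis_quat_def)

lemma sum_qunits: "(\<Sum>e\<in>qunits. F e) = F 1 + F quat_i + F quat_j + F quat_k"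
  for F :: "quat \<Rightarrow> 'a::comm_monoid_add"
proof -
  have "distinct [1, quat_i, quat_j, quat_k]"
    by (simp add: quat_eq_iff)
  then show ?thesis
    by (simp add: add.assoc)
qed

text \<open>
  Both sums consist of the rotations \<open>r\<^sup>\<mu>\<close> of one quaternion, \<open>r = p\<^sup>* q\<close> here and \<open>r = p q\<^sup>*\<close> below.
  Each imaginary part of \<open>r\<close> keeps its sign for two values of \<open>\<mu>\<close> and changes it for the other two;
  four times the real part of \<open>r\<close>, which is \<open>p \<bullet> q\<close>, remains.
\<close>

lemma sum_qcnj_qrot_mult_qrot:
  "(\<Sum>\<mu>\<in>qunits. qcnj (qrot \<mu> p) * qrot \<mu> q) = of_real (4 * (p \<bullet> q))"
  unfolding sum_qunits by (simp add: quat_eq_iff qrot_def inner_quat_def of_real_def algebra_simps)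

lemma sum_qrot_mult_qcnj_qrot:
  "(\<Sum>\<mu>\<in>qunits. qrot \<mu> p * qcnj (qrot \<mu> q)) = of_real (4 * (p \<bullet> q))"
  unfolding sum_qunits by (simp add: quat_eq_iff qrot_def inner_quat_def of_real_def algebra_simps)

text \<open>
  The common form of all left HR derivatives: \<open>u e = e\<^sup>\<mu>\<^sup>*\<close> gives \<open>\<partial>/\<partial>q\<^sup>\<mu>\<close>, and \<open>u e = e\<^sup>\<mu>\<close> gives
  \<open>\<partial>/\<partial>q\<^sup>\<mu>\<^sup>*\<close>. With it the two expansions of the theorem become one statement about a pair of
  families \<open>U\<close>, \<open>V\<close> that satisfies the frame identity.
\<close>

definition frame_deriv :: "(quat \<Rightarrow> quat) \<Rightarrow> (quat \<Rightarrow> quat) \<Rightarrow> quat \<Rightarrow> quat" where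
  "frame_deriv u f q = (1/4) *\<^sub>R (\<Sum>e\<in>qunits. qpartial e f q * u e)"

lemma HR_deriv_eq_frame_deriv:
  assumes "\<mu> \<in> qunits"
  shows "HR_deriv \<mu> = frame_deriv (\<lambda>e. qcnj (qrot \<mu> e))"
proof -
  have "qcnj (qrot \<mu> 1) = 1" "qcnj (qrot \<mu> quat_i) = - qrot \<mu> quat_i"
    "qcnj (qrot \<mu> quat_j) = - qrot \<mu> quat_j" "qcnj (qrot \<mu> quat_k) = - qrot \<mu> quat_k"
    using assms by (auto simp: quat_eq_iff qrot_def)
  then show ?thesis
    by (intro ext) (simp only: HR_deriv_def frame_deriv_def sum_qunits, simp)
qed

lemma HR_cderiv_eq_frame_deriv:
  assumes "\<mu> \<in> qunits"
  shows "HR_cderiv \<mu> = frame_deriv (qrot \<mu>)"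
proof -
  have "qrot \<mu> 1 = 1"
    using assms by (auto simp: quat_eq_iff qrot_def)
  then show ?thesis
    by (intro ext) (simp only: HR_cderiv_def frame_deriv_def sum_qunits, simp)
qed

text \<open>
  The partial derivatives stand on the left of every product, so they factor out of the sum over
  \<open>\<mu>\<close> and leave the frame identity. This collapses the linear sum of the expansion, and later the
  inner sum of the quadratic one, to a directional derivative.
\<close>

lemma sum_frame_deriv_mult:
  assumes frame: "\<And>p q. (\<Sum>\<mu>\<in>qunits. U \<mu> p * V \<mu> q) = of_real (4 * (p \<bullet> q))"
  shows "(\<Sum>\<mu>\<in>qunits. frame_deriv (U \<mu>) f q * V \<mu> h) = (\<Sum>e\<in>qunits. (h \<bullet> e) *\<^sub>R qpartial e f q)"
proof -
  have "(\<Sum>\<mu>\<in>qunits. frame_deriv (U \<mu>) f q * V \<mu> h)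
      = (\<Sum>\<mu>\<in>qunits. \<Sum>e\<in>qunits. (1/4) *\<^sub>R (qpartial e f q * (U \<mu> e * V \<mu> h)))"
    unfolding frame_deriv_def
    by (simp only: mult_scaleR_left sum_distrib_right scaleR_sum_right mult.assoc)
  also have "\<dots> = (\<Sum>e\<in>qunits. (1/4) *\<^sub>R (qpartial e f q * (\<Sum>\<mu>\<in>qunits. U \<mu> e * V \<mu> h)))"
    by (subst sum.swap) (simp only: sum_distrib_left scaleR_sum_right)
  also have "\<dots> = (\<Sum>e\<in>qunits. (h \<bullet> e) *\<^sub>R qpartial e f q)"
    unfolding frame by (intro sum.cong refl) (simp add: of_real_def inner_commute)
  finally show ?thesis .
qed

section \<open>From HR derivatives to partial derivatives\<close>

lemma has_vector_derivative_qpartial: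
  assumes "HR_differentiable_at f q" "e \<in> qunits"
  shows "((\<lambda>t. f (q + t *\<^sub>R e)) has_vector_derivative qpartial e f q) (at 0)"
  using assms unfolding HR_differentiable_at_def qpartial_def
  by (metis vector_derivative_works)

lemma qpartialI:
  "((\<lambda>t. f (q + t *\<^sub>R e)) has_vector_derivative D) (at 0) \<Longrightarrow> qpartial e f q = D"
  unfolding qpartial_def by (rule vector_derivative_at)

lemma HR_differentiable_atI:
  "(\<And>e. e \<in> qunits \<Longrightarrow> ((\<lambda>t. f (q + t *\<^sub>R e)) has_vector_derivative D e) (at 0)) \<Longrightarrow> HR_differentiable_at f q"
  unfolding HR_differentiable_at_def by (blast intro: differentiableI_vector)

text \<open>
  Equality of functions is typically known on the open set only, while \<open>qpartial\<close> is defined for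
  functions on all of \<open>quat\<close>; near \<open>0\<close>, the line stays in the open set.
\<close>

lemma has_vector_derivative_line_cong:
  fixes f g :: "'a::real_normed_vector \<Rightarrow> 'b::real_normed_vector"
  assumes "open S" "q \<in> S" and eq: "\<And>p. p \<in> S \<Longrightarrow> f p = g p"
    and "((\<lambda>t. f (q + t *\<^sub>R e)) has_vector_derivative D) (at 0)"
  shows "((\<lambda>t. g (q + t *\<^sub>R e)) has_vector_derivative D) (at 0)"
proof (rule has_vector_derivative_transform_within_open[OF assms(4)])
  show "open ((\<lambda>t. q + t *\<^sub>R e) -` S)"
    by (intro open_vimage assms continuous_intros)
qed (use assms in auto)

text \<open>
  The counterpart of \<open>HR_derivs_upto\<close> with iterated partial derivatives. Unlike the HR derivatives,
  these commute with right multiplication by constants, which makes the notion stable under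
  the combinations in \<open>partials_upto_right_combination\<close>.
\<close>

primrec partials_upto :: "nat \<Rightarrow> (quat \<Rightarrow> quat) \<Rightarrow> quat set \<Rightarrow> bool" where
  "partials_upto 0 f S \<longleftrightarrow> True"
| "partials_upto (Suc n) f S \<longleftrightarrow>
     (\<forall>q\<in>S. HR_differentiable_at f q) \<and>
     (\<forall>e\<in>qunits. continuous_on S (qpartial e f) \<and> partials_upto n (qpartial e f) S)"

lemma partials_upto_SucD:
  assumes "partials_upto (Suc n) f S"
  shows "q \<in> S \<Longrightarrow> HR_differentiable_at f q"
    and "e \<in> Basis \<Longrightarrow> continuous_on S (qpartial e f)"
    and "e \<in> Basis \<Longrightarrow> partials_upto n (qpartial e f) S"
  using assms unfolding Basis_quat_eq_qunits partials_upto.simps by blast+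

lemma partials_upto_cong:
  assumes "open S"
  shows "partials_upto n f S \<Longrightarrow> (\<And>q. q \<in> S \<Longrightarrow> f q = g q) \<Longrightarrow> partials_upto n g S"
proof (induction n arbitrary: f g)
  case (Suc n)
  have D: "((\<lambda>t. g (q + t *\<^sub>R e)) has_vector_derivative qpartial e f q) (at 0)"
    if "q \<in> S" "e \<in> qunits" for q e
    using Suc.prems that assms
    by (intro has_vector_derivative_line_cong[of S q f g] has_vector_derivative_qpartial) auto
  have eq: "qpartial e f q = qpartial e g q" if "q \<in> S" "e \<in> qunits" for q e
    using qpartialI[OF D[OF that]] by simp
  show ?case
    unfolding partials_upto.simps
  proof (intro conjI ballI)
    show "HR_differentiable_at g q" if "q \<in> S" for q
      using D[OF that] by (rule HR_differentiable_atI)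
    fix e assume e: "e \<in> qunits"
    have "continuous_on S (qpartial e f) = continuous_on S (qpartial e g)"
      by (rule continuous_on_cong[OF refl eq[OF _ e]])
    then show "continuous_on S (qpartial e g)"
      using Suc.prems(1) e by (simp only: partials_upto.simps)
    show "partials_upto n (qpartial e g) S"
    proof (rule Suc.IH)
      show "partials_upto n (qpartial e f) S"
        using Suc.prems(1) e by (simp only: partials_upto.simps)
    qed (rule eq[OF _ e])
  qed
qed simp

lemma has_vector_derivative_right_combination:
  assumes "\<And>i. i \<in> A \<Longrightarrow> HR_differentiable_at (F i) q" "e \<in> qunits"
  shows "((\<lambda>t. \<Sum>i\<in>A. F i (q + t *\<^sub>R e) * c i) has_vector_derivative
    (\<Sum>i\<in>A. qpartial e (F i) q * c i)) (at 0)"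
  using assms by (intro has_vector_derivative_sum has_vector_derivative_mult_left has_vector_derivative_qpartial)

lemma partials_upto_right_combination:
  assumes "open S"
  shows "(\<And>i. i \<in> A \<Longrightarrow> partials_upto n (F i) S) \<Longrightarrow> partials_upto n (\<lambda>q. \<Sum>i\<in>A. F i q * c i) S"
proof (induction n arbitrary: F)
  case (Suc n)
  note D = has_vector_derivative_right_combination[of A F _ _ c]
  have diff: "HR_differentiable_at (F i) q" if "i \<in> A" "q \<in> S" for i q
    using Suc.prems[OF that(1)] that(2) by simp
  have eq: "(\<Sum>i\<in>A. qpartial e (F i) q * c i) = qpartial e (\<lambda>q. \<Sum>i\<in>A. F i q * c i) q"
    if "q \<in> S" "e \<in> qunits" for q e
    using qpartialI[OF D] that diff by simp
  show ?case
    unfolding partials_upto.simps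
  proof (intro conjI ballI)
    show "HR_differentiable_at (\<lambda>q. \<Sum>i\<in>A. F i q * c i) q" if "q \<in> S" for q
      by (rule HR_differentiable_atI) (rule D[OF diff[OF _ that]])
    fix e assume e: "e \<in> qunits"
    have "continuous_on S (\<lambda>q. \<Sum>i\<in>A. qpartial e (F i) q * c i)"
      using Suc.prems e by (intro continuous_intros) (simp only: partials_upto.simps)
    moreover have "continuous_on S (\<lambda>q. \<Sum>i\<in>A. qpartial e (F i) q * c i)
        = continuous_on S (qpartial e (\<lambda>q. \<Sum>i\<in>A. F i q * c i))"
      by (rule continuous_on_cong[OF refl eq[OF _ e]])
    ultimately show "continuous_on S (qpartial e (\<lambda>q. \<Sum>i\<in>A. F i q * c i))"
      by (simp only:)
    have "partials_upto n (\<lambda>q. \<Sum>i\<in>A. qpartial e (F i) q * c i) S"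
      using Suc.prems e by (intro Suc.IH) (simp only: partials_upto.simps)
    then show "partials_upto n (qpartial e (\<lambda>q. \<Sum>i\<in>A. F i q * c i)) S"
      by (rule partials_upto_cong[OF assms]) (rule eq[OF _ e])
  qed
qed simp

text \<open>
  The inversion of the definition of the HR derivatives: this is \<open>sum_frame_deriv_mult\<close> with
  \<open>h = e\<close>, where orthonormality of the units singles out one partial derivative.
\<close>

lemma qpartial_eq_sum_HR_deriv:
  assumes "e \<in> qunits"
  shows "qpartial e f = (\<lambda>q. \<Sum>\<mu>\<in>qunits. HR_deriv \<mu> f q * qrot \<mu> e)"
proof
  fix q
  have "(\<Sum>\<mu>\<in>qunits. HR_deriv \<mu> f q * qrot \<mu> e)
      = (\<Sum>\<mu>\<in>qunits. frame_deriv (\<lambda>e. qcnj (qrot \<mu> e)) f q * qrot \<mu> e)"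
    by (intro sum.cong refl) (simp only: HR_deriv_eq_frame_deriv)
  also have "\<dots> = (\<Sum>a\<in>Basis. (e \<bullet> a) *\<^sub>R qpartial a f q)"
    unfolding Basis_quat_eq_qunits by (rule sum_frame_deriv_mult) (rule sum_qcnj_qrot_mult_qrot)
  also have "\<dots> = (\<Sum>a\<in>Basis. if a = e then qpartial a f q else 0)"
    using assms by (intro sum.cong refl) (simp add: inner_Basis Basis_quat_eq_qunits)
  also have "\<dots> = qpartial e f q"
    using assms by (simp add: Basis_quat_eq_qunits sum.delta del: sum.insert)
  finally show "qpartial e f q = (\<Sum>\<mu>\<in>qunits. HR_deriv \<mu> f q * qrot \<mu> e)" by simp
qed

text \<open>
  Each \<open>qpartial e f\<close> is a right combination of the functions \<open>HR_deriv \<mu> f\<close>, to which the induction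
  hypothesis applies. A direct induction that keeps \<open>HR_derivs_upto\<close> for \<open>qpartial e f\<close> would fail:
  in an HR derivative of \<open>g c\<close> the constant \<open>c\<close> stands between \<open>\<partial>\<^sub>e g\<close> and \<open>e\<^sup>\<mu>\<close>.
\<close>

lemma HR_derivs_upto_imp_partials_upto:
  assumes "open S"
  shows "HR_derivs_upto n f S \<Longrightarrow> partials_upto n f S"
proof (induction n arbitrary: f)
  case (Suc n)
  note * = Suc.prems[unfolded HR_derivs_upto.simps]
  show ?case
    unfolding partials_upto.simps
  proof (intro conjI ballI)
    show "HR_differentiable_at f q" if "q \<in> S" for q
      using * that by blast
    fix e assume e: "e \<in> qunits"
    show "continuous_on S (qpartial e f)"
      unfolding qpartial_eq_sum_HR_deriv[OF e] using * by (intro continuous_intros) blast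
    show "partials_upto n (qpartial e f) S"
      unfolding qpartial_eq_sum_HR_deriv[OF e]
      using * by (intro partials_upto_right_combination[OF assms] Suc.IH) blast
  qed
qed simp

section \<open>The second-order expansion in a frame\<close>

lemma partials_upto_has_derivative:
  assumes "open S" "q \<in> S" "partials_upto (Suc n) f S"
  shows "(f has_derivative (\<lambda>h. \<Sum>e\<in>Basis. (h \<bullet> e) *\<^sub>R qpartial e f q)) (at q)"
  using assms by (intro has_derivative_continuous_partials[of S] has_vector_derivative_qpartial)
    (auto simp only: partials_upto.simps Basis_quat_eq_qunits)


text \<open>
  A real-valued function equals its own real part, and taking the real part is a bounded linear map,
  so it commutes with the derivative.
\<close>

lemma qpartial_real_valued:
  assumes "open S" "q \<in> S" "HR_differentiable_at f q" "e \<in> qunits"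
    and real: "\<And>p. p \<in> S \<Longrightarrow> f p \<in> \<real>"
  shows "qpartial e f q \<in> \<real>"
proof -
  have real_iff: "p \<in> \<real> \<longleftrightarrow> of_real (qa p) = p" for p :: quat
    by (metis Reals_cases Reals_of_real mult.right_neutral of_real_def one_quat.sel(1) scaleR_quat.sel(1))
  have "bounded_linear (\<lambda>p :: quat. of_real (p \<bullet> 1) :: quat)"
    by (rule bounded_linear_compose[OF bounded_linear_of_real bounded_linear_inner_left])
  then have "bounded_linear (\<lambda>p. of_real (qa p) :: quat)"
    by (simp add: inner_quat_def)
  from bounded_linear.has_vector_derivative[OF this has_vector_derivative_qpartial[OF assms(3,4)]]
  have "((\<lambda>t. of_real (qa (f (q + t *\<^sub>R e))) :: quat) has_vector_derivative of_real (qa (qpartial e f q))) (at 0)" .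
  then have "((\<lambda>t. f (q + t *\<^sub>R e)) has_vector_derivative of_real (qa (qpartial e f q))) (at 0)"
    using assms(1,2) real real_iff
    by (intro has_vector_derivative_line_cong[of S q "\<lambda>p. of_real (qa (f p))" f]) auto
  from qpartialI[OF this] show ?thesis
    unfolding real_iff by (rule sym)
qed

text \<open>
  For fixed \<open>\<mu>\<close>, the sum over \<open>\<nu>\<close> is the directional derivative of \<open>frame_deriv (V \<mu>) f\<close> along
  \<open>h\<close>. The resulting second partial derivatives stand between \<open>U \<mu> h\<close> and \<open>V \<mu> a\<close>; being real they
  can be pulled out, and the frame identity applies again, now to the sum over \<open>\<mu>\<close>. For this the
  inner derivative has to be built from \<open>V\<close> when the outer one is built from \<open>U\<close>, which is
  the reason for the mixed derivatives \<open>\<partial>\<^sup>2f/\<partial>q\<^sup>\<nu>\<partial>q\<^sup>\<mu>\<^sup>*\<close> in the expansion.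
\<close>

lemma quadratic_frame_form:
  assumes frame: "\<And>p q. (\<Sum>\<mu>\<in>qunits. U \<mu> p * V \<mu> q) = of_real (4 * (p \<bullet> q))"
    and diff: "\<And>e. e \<in> qunits \<Longrightarrow> HR_differentiable_at (qpartial e f) q"
    and real: "\<And>a b. a \<in> qunits \<Longrightarrow> b \<in> qunits \<Longrightarrow> qpartial b (qpartial a f) q \<in> \<real>"
  shows "(\<Sum>\<mu>\<in>qunits. \<Sum>\<nu>\<in>qunits. U \<mu> h * frame_deriv (U \<nu>) (frame_deriv (V \<mu>) f) q * V \<nu> h)
    = (\<Sum>a\<in>qunits. \<Sum>b\<in>qunits. ((h \<bullet> a) * (h \<bullet> b)) *\<^sub>R qpartial b (qpartial a f) q)"
proof -
  have inner: "qpartial b (frame_deriv v f) q = (1/4) *\<^sub>R (\<Sum>a\<in>qunits. qpartial b (qpartial a f) q * v a)"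
    if "b \<in> qunits" for b v
    unfolding frame_deriv_def[abs_def]
    by (intro qpartialI bounded_linear.has_vector_derivative[OF bounded_linear_scaleR_right]
        has_vector_derivative_right_combination diff that)
  have "(\<Sum>\<mu>\<in>qunits. \<Sum>\<nu>\<in>qunits. U \<mu> h * frame_deriv (U \<nu>) (frame_deriv (V \<mu>) f) q * V \<nu> h)
      = (\<Sum>\<mu>\<in>qunits. U \<mu> h * (\<Sum>b\<in>qunits. (h \<bullet> b) *\<^sub>R qpartial b (frame_deriv (V \<mu>) f) q))"
    unfolding sum_frame_deriv_mult[OF frame, symmetric] by (simp only: sum_distrib_left mult.assoc)
  also have "\<dots> = (\<Sum>\<mu>\<in>qunits. \<Sum>b\<in>qunits. \<Sum>a\<in>qunits.
      ((h \<bullet> b) / 4) *\<^sub>R (qpartial b (qpartial a f) q * (U \<mu> h * V \<mu> a)))"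
  proof -
    have comm: "u * (p * v) = p * (u * v)" if "p \<in> \<real>" for u p v :: quat
      using that by (auto simp: Reals_def of_real_def)
    show ?thesis
    proof (intro sum.cong refl)
      fix \<mu>
      have "U \<mu> h * (\<Sum>b\<in>qunits. (h \<bullet> b) *\<^sub>R qpartial b (frame_deriv (V \<mu>) f) q)
          = (\<Sum>b\<in>qunits. \<Sum>a\<in>qunits. ((h \<bullet> b) / 4) *\<^sub>R (U \<mu> h * (qpartial b (qpartial a f) q * V \<mu> a)))"
        unfolding sum_distrib_left
      proof (rule sum.cong[OF refl])
        fix b assume b: "b \<in> qunits"
        show "U \<mu> h * ((h \<bullet> b) *\<^sub>R qpartial b (frame_deriv (V \<mu>) f) q)
            = (\<Sum>a\<in>qunits. ((h \<bullet> b) / 4) *\<^sub>R (U \<mu> h * (qpartial b (qpartial a f) q * V \<mu> a)))"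
          by (simp add: inner[OF b] sum_distrib_left scaleR_sum_right del: sum.insert)
      qed
      also have "\<dots> = (\<Sum>b\<in>qunits. \<Sum>a\<in>qunits. ((h \<bullet> b) / 4) *\<^sub>R (qpartial b (qpartial a f) q * (U \<mu> h * V \<mu> a)))"
        by (intro sum.cong refl arg_cong[of _ _ "scaleR _"] comm real)
      finally show "U \<mu> h * (\<Sum>b\<in>qunits. (h \<bullet> b) *\<^sub>R qpartial b (frame_deriv (V \<mu>) f) q) = \<dots>" .
    qed
  qed
  also have "\<dots> = (\<Sum>b\<in>qunits. \<Sum>a\<in>qunits. \<Sum>\<mu>\<in>qunits.
      ((h \<bullet> b) / 4) *\<^sub>R (qpartial b (qpartial a f) q * (U \<mu> h * V \<mu> a)))"
    by (subst sum.swap) (intro sum.cong refl sum.swap)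
  also have "\<dots> = (\<Sum>b\<in>qunits. \<Sum>a\<in>qunits.
      ((h \<bullet> b) / 4) *\<^sub>R (qpartial b (qpartial a f) q * (\<Sum>\<mu>\<in>qunits. U \<mu> h * V \<mu> a)))"
    by (simp only: sum_distrib_left scaleR_sum_right)
  also have "\<dots> = (\<Sum>b\<in>qunits. \<Sum>a\<in>qunits. ((h \<bullet> a) * (h \<bullet> b)) *\<^sub>R qpartial b (qpartial a f) q)"
    unfolding frame by (intro sum.cong refl) (simp add: of_real_def)
  also have "\<dots> = (\<Sum>a\<in>qunits. \<Sum>b\<in>qunits. ((h \<bullet> a) * (h \<bullet> b)) *\<^sub>R qpartial b (qpartial a f) q)"
    by (rule sum.swap)
  finally show ?thesis .
qed


text \<open>
  The linear and the quadratic sum are the terms of the Taylor polynomial of \<open>second_order_Taylor_bound\<close>, read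
  in the real coordinates. The bound holds on a ball, hence along every filter \<open>at 0 within T\<close>.
\<close>

lemma frame_Taylor_expansion:
  assumes "open S" "q0 \<in> S" and f: "partials_upto 3 (of_real \<circ> f) S"
    and frame: "\<And>p q. (\<Sum>\<mu>\<in>qunits. U \<mu> p * V \<mu> q) = of_real (4 * (p \<bullet> q))"
    and D: "\<And>\<mu>. \<mu> \<in> qunits \<Longrightarrow> D \<mu> = frame_deriv (U \<mu>)"
    and D': "\<And>\<mu>. \<mu> \<in> qunits \<Longrightarrow> D' \<mu> = frame_deriv (V \<mu>)"
  shows "(\<lambda>h. norm (of_real (f (q0 + h) - f q0)
        - ((\<Sum>\<mu>\<in>qunits. D \<mu> (of_real \<circ> f) q0 * V \<mu> h)
           + (1/2) *\<^sub>R (\<Sum>\<mu>\<in>qunits. \<Sum>\<nu>\<in>qunits.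
               U \<mu> h * D \<nu> (D' \<mu> (of_real \<circ> f)) q0 * V \<nu> h))))
      \<in> O[at 0 within T](\<lambda>h. norm h ^ 3)"
proof -
  define g :: "quat \<Rightarrow> quat" where "g = of_real \<circ> f"
  have P3: "partials_upto (Suc (Suc (Suc 0))) g S"
    using f by (simp add: g_def numeral_3_eq_3)
  have P2: "partials_upto (Suc (Suc 0)) (qpartial a g) S" if "a \<in> Basis" for a
    using P3 that by (rule partials_upto_SucD)
  have P1: "partials_upto (Suc 0) (qpartial b (qpartial a g)) S" if "a \<in> Basis" "b \<in> Basis" for a b
    using P2[OF that(1)] that(2) by (rule partials_upto_SucD)
  have cont: "continuous_on S (qpartial c (qpartial b (qpartial a g)))"
    if "a \<in> Basis" "b \<in> Basis" "c \<in> Basis" for a b c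
    using P1[OF that(1,2)] that(3) by (rule partials_upto_SucD)
  have diff: "HR_differentiable_at g q" "a \<in> qunits \<Longrightarrow> HR_differentiable_at (qpartial a g) q"
    if "q \<in> S" for a q
    using partials_upto_SucD(1)[OF P3 that] partials_upto_SucD(1)[OF P2 that]
    unfolding Basis_quat_eq_qunits by blast+
  have real1: "qpartial a g q \<in> \<real>" if "a \<in> qunits" "q \<in> S" for a q
    by (rule qpartial_real_valued[OF \<open>open S\<close> that(2) diff(1) that(1)]) (simp_all add: that g_def)
  have real2: "qpartial b (qpartial a g) q \<in> \<real>" if "a \<in> qunits" "b \<in> qunits" "q \<in> S" for a b q
    by (rule qpartial_real_valued[OF \<open>open S\<close> that(3) diff(2) that(2)]) (use that real1 in auto)
  obtain r M where r: "r > 0" and bound: "\<And>h. norm h < r \<Longrightarrow>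
      norm (g (q0 + h) - g q0 - ((\<Sum>a\<in>Basis. (h \<bullet> a) *\<^sub>R qpartial a g q0)
        + (1/2) *\<^sub>R (\<Sum>a\<in>Basis. \<Sum>b\<in>Basis. ((h \<bullet> a) * (h \<bullet> b)) *\<^sub>R qpartial b (qpartial a g) q0)))
      \<le> M * norm h ^ 3"
    by (rule second_order_Taylor_bound[OF \<open>open S\<close> \<open>q0 \<in> S\<close>, of g "\<lambda>a. qpartial a g"
          "\<lambda>a b. qpartial b (qpartial a g)" "\<lambda>a b c. qpartial c (qpartial b (qpartial a g))"])
      (blast intro: partials_upto_has_derivative[OF \<open>open S\<close>] P3 P2 P1 cont)+
  have quad: "(\<Sum>\<mu>\<in>qunits. \<Sum>\<nu>\<in>qunits. U \<mu> h * D \<nu> (D' \<mu> g) q0 * V \<nu> h)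
      = (\<Sum>a\<in>Basis. \<Sum>b\<in>Basis. ((h \<bullet> a) * (h \<bullet> b)) *\<^sub>R qpartial b (qpartial a g) q0)" for h
  proof -
    have "(\<Sum>\<mu>\<in>qunits. \<Sum>\<nu>\<in>qunits. U \<mu> h * D \<nu> (D' \<mu> g) q0 * V \<nu> h)
        = (\<Sum>\<mu>\<in>qunits. \<Sum>\<nu>\<in>qunits. U \<mu> h * frame_deriv (U \<nu>) (frame_deriv (V \<mu>) g) q0 * V \<nu> h)"
      by (intro sum.cong refl) (simp only: D D')
    also have "\<dots> = (\<Sum>a\<in>Basis. \<Sum>b\<in>Basis. ((h \<bullet> a) * (h \<bullet> b)) *\<^sub>R qpartial b (qpartial a g) q0)"
      unfolding Basis_quat_eq_qunits
      by (rule quadratic_frame_form[OF frame]) (use diff real2 \<open>q0 \<in> S\<close> in blast)+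
    finally show ?thesis .
  qed
  have lin: "(\<Sum>\<mu>\<in>qunits. D \<mu> g q0 * V \<mu> h) = (\<Sum>a\<in>Basis. (h \<bullet> a) *\<^sub>R qpartial a g q0)" for h
  proof -
    have "(\<Sum>\<mu>\<in>qunits. D \<mu> g q0 * V \<mu> h) = (\<Sum>\<mu>\<in>qunits. frame_deriv (U \<mu>) g q0 * V \<mu> h)"
      by (intro sum.cong refl) (simp only: D)
    then show ?thesis
      unfolding Basis_quat_eq_qunits sum_frame_deriv_mult[OF frame] .
  qed
  have diff_g: "of_real (f (q0 + h) - f q0) = g (q0 + h) - g q0" for h
    by (simp add: g_def)
  show ?thesis
    unfolding g_def[symmetric] quad lin diff_g
  proof (rule bigoI[of _ M])
    show "\<forall>\<^sub>F h in at 0 within T. norm (norm (g (q0 + h) - g q0 - ((\<Sum>a\<in>Basis. (h \<bullet> a) *\<^sub>R qpartial a g q0)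
        + (1/2) *\<^sub>R (\<Sum>a\<in>Basis. \<Sum>b\<in>Basis. ((h \<bullet> a) * (h \<bullet> b)) *\<^sub>R qpartial b (qpartial a g) q0))))
      \<le> M * norm (norm h ^ 3)"
      unfolding eventually_at using r bound by (intro exI[of _ r]) simp
  qed
qed

theorem theorem3p22:
  fixes S :: "quat set" and f :: "quat \<Rightarrow> real" and q0 :: quat
  assumes "open S"
    and "continuous_on S f"
    and "HR_derivs_upto 3 (of_real \<circ> f) S"
    and "q0 \<in> S"
  shows
    "(\<lambda>h. norm (of_real (f (q0 + h) - f q0)
        - ((\<Sum>\<mu>\<in>qunits. HR_deriv \<mu> (of_real \<circ> f) q0 * qrot \<mu> h)
           + (1/2) *\<^sub>R (\<Sum>\<mu>\<in>qunits. \<Sum>\<nu>\<in>qunits.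
               qcnj (qrot \<mu> h) * HR_deriv \<nu> (HR_cderiv \<mu> (of_real \<circ> f)) q0 * qrot \<nu> h))))
      \<in> O[at 0 within {h. q0 + h \<in> S \<and> closed_segment q0 (q0 + h) \<subseteq> S}](\<lambda>h. norm h ^ 3)
    \<and>
     (\<lambda>h. norm (of_real (f (q0 + h) - f q0)
        - ((\<Sum>\<mu>\<in>qunits. HR_cderiv \<mu> (of_real \<circ> f) q0 * qcnj (qrot \<mu> h))
           + (1/2) *\<^sub>R (\<Sum>\<mu>\<in>qunits. \<Sum>\<nu>\<in>qunits.
               qrot \<mu> h * HR_cderiv \<nu> (HR_deriv \<mu> (of_real \<circ> f)) q0 * qcnj (qrot \<nu> h)))))
      \<in> O[at 0 within {h. q0 + h \<in> S \<and> closed_segment q0 (q0 + h) \<subseteq> S}](\<lambda>h. norm h ^ 3)"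
proof
  note partials = HR_derivs_upto_imp_partials_upto[OF assms(1,3)]
  note Taylor = frame_Taylor_expansion[OF assms(1,4) partials]
  show "(\<lambda>h. norm (of_real (f (q0 + h) - f q0)
        - ((\<Sum>\<mu>\<in>qunits. HR_deriv \<mu> (of_real \<circ> f) q0 * qrot \<mu> h)
           + (1/2) *\<^sub>R (\<Sum>\<mu>\<in>qunits. \<Sum>\<nu>\<in>qunits.
               qcnj (qrot \<mu> h) * HR_deriv \<nu> (HR_cderiv \<mu> (of_real \<circ> f)) q0 * qrot \<nu> h))))
      \<in> O[at 0 within {h. q0 + h \<in> S \<and> closed_segment q0 (q0 + h) \<subseteq> S}](\<lambda>h. norm h ^ 3)"
    by (rule Taylor[where U="\<lambda>\<mu> p. qcnj (qrot \<mu> p)" and V=qrot, OF sum_qcnj_qrot_mult_qrot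
          HR_deriv_eq_frame_deriv HR_cderiv_eq_frame_deriv])
  show "(\<lambda>h. norm (of_real (f (q0 + h) - f q0)
        - ((\<Sum>\<mu>\<in>qunits. HR_cderiv \<mu> (of_real \<circ> f) q0 * qcnj (qrot \<mu> h))
           + (1/2) *\<^sub>R (\<Sum>\<mu>\<in>qunits. \<Sum>\<nu>\<in>qunits.
               qrot \<mu> h * HR_cderiv \<nu> (HR_deriv \<mu> (of_real \<circ> f)) q0 * qcnj (qrot \<nu> h)))))
      \<in> O[at 0 within {h. q0 + h \<in> S \<and> closed_segment q0 (q0 + h) \<subseteq> S}](\<lambda>h. norm h ^ 3)"
    by (rule Taylor[where U=qrot and V="\<lambda>\<mu> p. qcnj (qrot \<mu> p)", OF sum_qrot_mult_qcnj_qrot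
          HR_cderiv_eq_frame_deriv HR_deriv_eq_frame_deriv])
qed

end
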